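(* Let $t\ge 2$, $r<k\le 2r$ and $n\ge 8t^2$ be integers (with $r\ge 1$). Then \[ \mathrm{ex}_k(n, K_{r+1}(t))\ \ge\ t_r(k)n^2 + z_t(n, n) + (t-1)(k-r-1)n + \min\{k-r-1,\, 2r-k\}\left\lfloor \frac{(t-1)^2}{4} \right\rfloor. \]
   Context: $K_{r+1}(t)$ denotes the complete $(r+1)$-partite graph with exactly $t$ vertices in each part. For integers $k,n$, $\mathcal G_k(n)$ is the family of $k$-partite graphs with $k$ given vertex classes $V_1,\dots,V_k$, each of size $n$ (edges only join vertices in different classes). For a graph $F$, $\mathrm{ex}_k(n,F)$ is the maximum number of edges of a graph in $\mathcal G_k(n)$ containing no copy of $F$ as a subgraph. $t_r(k)$ is the number of edges of the Turán graph $T_r(k)$, the complete $r$-partite graph on $k$ vertices with part sizes $\lfloor k/r\rfloor$ or $\lceil k/r\rceil$. $z_t(m,n)$ (Zarankiewicz number) is the maximum number of edges in a bipartite graph with parts of sizes $m$ and $n$ containing no copy of $K_{t,t}$. *)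

theory Defs
  imports "HOL-Library.Ramsey"
begin

text \<open>
  Finite simple graphs: an edge is a two-element set of vertices
  (\<open>[V]\<^bsup>2\<^esup>\<close> is \<^const>\<open>nsets\<close> \<open>V 2\<close>).
\<close>

record 'a ugraph =
  verts :: "'a set"
  edges :: "'a set set"

definition simple_graph :: "'a ugraph \<Rightarrow> bool" where
  "simple_graph G \<longleftrightarrow> finite (verts G) \<and> edges G \<subseteq> [verts G]\<^bsup>2\<^esup>"

text \<open>A copy of \<open>F\<close> in \<open>G\<close> is a subgraph of \<open>G\<close>, not necessarily induced, isomorphic to \<open>F\<close>.\<close>

definition contains_copy :: "'a ugraph \<Rightarrow> 'b ugraph \<Rightarrow> bool" where
  "contains_copy F G \<longleftrightarrow>
     (\<exists>f. inj_on f (verts F) \<and> f ` verts F \<subseteq> verts G \<and> (\<forall>e\<in>edges F. f ` e \<in> edges G))"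

text \<open>
  In the following, \<open>k\<close>-partite graphs have \<open>k\<close> given, possibly empty, vertex classes: the
  \<open>i\<close>-th class, for \<open>i < k\<close>, is \<open>{i} \<times> {..<s i}\<close>, so \<open>s i\<close> is its size.
\<close>

definition complete_multipartite :: "nat \<Rightarrow> (nat \<Rightarrow> nat) \<Rightarrow> (nat \<times> nat) ugraph" where
  "complete_multipartite k s =
     \<lparr>verts = (SIGMA i:{..<k}. {..<s i}),
      edges = {{(i, x), (j, y)} | i x j y. i < k \<and> j < k \<and> i \<noteq> j \<and> x < s i \<and> y < s j}\<rparr>"

definition multipartite_graphs :: "nat \<Rightarrow> (nat \<Rightarrow> nat) \<Rightarrow> (nat \<times> nat) ugraph set" where
  "multipartite_graphs k s =
     {G. verts G = (SIGMA i:{..<k}. {..<s i}) \<and>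
         edges G \<subseteq> edges (complete_multipartite k s)}"

text \<open>\<open>K_parts p t\<close> is $K_p(t)$; in particular \<open>K_parts 2 t\<close> is $K_{t,t}$.\<close>

definition K_parts :: "nat \<Rightarrow> nat \<Rightarrow> (nat \<times> nat) ugraph" where
  "K_parts p t = complete_multipartite p (\<lambda>_. t)"

text \<open>
  The maxima below range over finite sets, which are nonempty whenever the forbidden graph has
  an edge (lemma \<open>max_edges_attained\<close>).
\<close>

definition max_edges_avoiding :: "(nat \<times> nat) ugraph set \<Rightarrow> 'b ugraph \<Rightarrow> nat" where
  "max_edges_avoiding \<G> F = Max {card (edges G) | G. G \<in> \<G> \<and> \<not> contains_copy F G}"

definition ex_partite :: "nat \<Rightarrow> nat \<Rightarrow> 'b ugraph \<Rightarrow> nat" where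
  "ex_partite k n F = max_edges_avoiding (multipartite_graphs k (\<lambda>_. n)) F"

definition zarankiewicz :: "nat \<Rightarrow> nat \<Rightarrow> nat \<Rightarrow> nat" where
  "zarankiewicz t m n =
     max_edges_avoiding (multipartite_graphs 2 (\<lambda>i. if i = 0 then m else n)) (K_parts 2 t)"

text \<open>
  Exactly \<open>k mod r\<close> of the \<open>r\<close> parts of the Turan graph on \<open>k\<close> vertices have size
  \<open>\<lfloor>k / r\<rfloor> + 1\<close>, which is \<open>\<lceil>k / r\<rceil>\<close> if there are any.
\<close>

definition turan_graph :: "nat \<Rightarrow> nat \<Rightarrow> (nat \<times> nat) ugraph" where
  "turan_graph r k = complete_multipartite r (\<lambda>i. if i < k mod r then k div r + 1 else k div r)"

definition turan_number :: "nat \<Rightarrow> nat \<Rightarrow> nat" where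
  "turan_number r k = card (edges (turan_graph r k))"

lemma finite_verts_multipartite: "finite (SIGMA i:{..<k::nat}. {..<s i :: nat})"
  by simp

lemma edges_complete_multipartite:
  "edges (complete_multipartite k s) \<subseteq> [SIGMA i:{..<k}. {..<s i}]\<^bsup>2\<^esup>"
  by (auto simp: complete_multipartite_def nsets_def)

lemma simple_graph_multipartite:
  "G \<in> multipartite_graphs k s \<Longrightarrow> simple_graph G"
  using edges_complete_multipartite[of k s]
  by (auto simp: multipartite_graphs_def simple_graph_def)

lemma complete_multipartite_in: "complete_multipartite k s \<in> multipartite_graphs k s"
  by (simp add: multipartite_graphs_def complete_multipartite_def)

lemma card_verts_turan_graph:
  assumes "r > 0"
  shows "card (verts (turan_graph r k)) = k"
proof -
  have le: "k mod r \<le> r" using assms by simp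
  have "card (verts (turan_graph r k)) = (\<Sum>i<r. k div r + (if i < k mod r then 1 else 0))"
    by (simp add: turan_graph_def complete_multipartite_def) (rule sum.cong, auto)
  also have "\<dots> = r * (k div r) + card ({..<r} \<inter> {i. i < k mod r})"
    by (simp add: sum.distrib sum.If_cases)
  also have "{..<r} \<inter> {i. i < k mod r} = {..<k mod r}"
    using le by auto
  finally show ?thesis by simp
qed

lemma max_edges_attained:
  fixes k :: nat and s :: "nat \<Rightarrow> nat"
  assumes "edges F \<noteq> {}"
  defines "\<G> \<equiv> multipartite_graphs k s"
  shows "\<exists>G\<in>\<G>. \<not> contains_copy F G \<and> card (edges G) = max_edges_avoiding \<G> F"
    and "\<And>G. G \<in> \<G> \<Longrightarrow> \<not> contains_copy F G \<Longrightarrow> card (edges G) \<le> max_edges_avoiding \<G> F"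
proof -
  let ?S = "{card (edges G) | G. G \<in> \<G> \<and> \<not> contains_copy F G}"
  let ?C = "edges (complete_multipartite k s)"
  have "finite ?C"
    using edges_complete_multipartite[of k s] finite_imp_finite_nsets[OF finite_verts_multipartite]
    by (rule finite_subset)
  then have "?S \<subseteq> {..card ?C}"
    by (auto simp: \<G>_def multipartite_graphs_def intro: card_mono)
  then have fin: "finite ?S" by (rule finite_subset) simp
  let ?E = "\<lparr>verts = (SIGMA i:{..<k}. {..<s i}), edges = {}\<rparr>"
  have "?E \<in> \<G>" "\<not> contains_copy F ?E"
    using assms(1) by (auto simp: \<G>_def multipartite_graphs_def contains_copy_def)
  then have ne: "?S \<noteq> {}" by blast
  show "\<exists>G\<in>\<G>. \<not> contains_copy F G \<and> card (edges G) = max_edges_avoiding \<G> F"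
    using Max_in[OF fin ne] unfolding max_edges_avoiding_def by force
  show "\<And>G. G \<in> \<G> \<Longrightarrow> \<not> contains_copy F G \<Longrightarrow> card (edges G) \<le> max_edges_avoiding \<G> F"
    unfolding max_edges_avoiding_def using Max_ge[OF fin] by blast
qed

end

theory Submission
  imports Defs "HOL-Library.Z2" "HOL-Number_Theory.Cong"
    "HOL-Algebra.Algebraic_Closure_Type" "HOL-Algebra.Multiplicative_Group"
begin

text \<open>
  The extremal graph is a join of blocks, one for each of the \<open>r\<close> parts of the Turan graph: an
  extremal \<open>K\<^sub>t\<^sub>,\<^sub>t\<close>-free graph on one pair of classes, \<open>(t - 1)\<close>-regular \<open>C\<^sub>4\<close>-free
  graphs on the other \<open>k - r - 1\<close> pairs, and \<open>2 r - k\<close> single classes. A \<open>C\<^sub>4\<close>-free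
  bipartite graph of maximum degree at most \<open>t - 1\<close> contains at most \<open>t\<close> vertices of any copy of
  \<open>K\<^sub>r\<^sub>+\<^sub>1(t)\<close>, as its only complete bipartite subgraphs are stars; the \<open>K\<^sub>t\<^sub>,\<^sub>t\<close>-free block
  contains at most \<open>2 t - 1\<close>. Hence a copy would have at most \<open>(r + 1) t - 1\<close> vertices.

  The last summand is gained by merging a pair \<open>A, B\<close> with a single class \<open>C\<close>: sets of
  \<open>h = \<lfloor>(t - 1) / 2\<rfloor>\<close> vertices of \<open>A\<close> and of \<open>B\<close> move to the part of \<open>C\<close>. They are joined
  completely to the rest of \<open>A \<union> B\<close> and to each other, as far as they lie in different classes,
  and to \<open>C\<close> only by disjoint stars with \<open>t - 1\<close> leaves. The three classes still contain at
  most \<open>2 t\<close> vertices of a copy: if it meets both moved sets, then it has only two colours there,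
  because no vertex of \<open>C\<close> is adjacent to both sets. Compared with a \<open>(t - 1)\<close>-regular graph
  between \<open>A\<close> and \<open>B\<close> and all edges to \<open>C\<close>, this gains \<open>h (t - 1 - h)\<close> edges.
\<close>

subsection \<open>Sidon sets and regular \<open>C\<^sub>4\<close>-free bipartite graphs\<close>

text \<open>The polynomial \<open>X^Q - X\<close> has derivative -1 in characteristic two, so over
  an algebraically closed field it splits into \<open>Q\<close> distinct linear factors.\<close>

lemma card_frobenius_fixed:
  assumes two: "(2 :: 'a :: alg_closed_field) = 0" and "j \<ge> 1"
  shows "card {x :: 'a. x ^ (2 ^ j) = x} = 2 ^ j"
proof -
  define Q :: nat where "Q = 2 ^ j"
  have Q: "Q \<ge> 2" "of_nat Q = (0 :: 'a)"
    using \<open>j \<ge> 1\<close> two by (cases j; simp add: Q_def)+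
  define p :: "'a poly" where "p = monom 1 Q + [:0, -1:]"
  have "degree p = Q" and lc: "lead_coeff p = 1"
  proof -
    show "degree p = Q" unfolding p_def
      using Q by (subst degree_add_eq_left) (auto simp: degree_monom_eq)
    then show "lead_coeff p = 1" using Q by (auto simp: p_def coeff_pCons split: nat.split)
  qed
  then have "p \<noteq> 0" by auto
  have root: "poly p x = x ^ Q - x" for x
    by (simp add: p_def poly_monom)
  have deriv: "poly (pderiv p) x = -1" for x
    using Q by (simp add: p_def pderiv_add pderiv_monom pderiv_pCons poly_monom)
  obtain A where A: "size A = degree p" "p = (\<Prod>x\<in>#A. [:-x, 1:])"
    using alg_closed_imp_factorization[OF \<open>p \<noteq> 0\<close>] lc by auto
  have "count A x \<le> 1" for x
  proof (rule ccontr)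
    assume "\<not> count A x \<le> 1"
    then have "{#x, x#} \<subseteq># A" by (simp add: subseteq_mset_def)
    then obtain B where "A = {#x, x#} + B" by (auto simp: mset_subset_eq_exists_conv)
    then have "p = [:-x, 1:] * ([:-x, 1:] * (\<Prod>x\<in>#B. [:-x, 1:]))"
      by (simp add: A(2))
    then have "poly (pderiv p) x = 0"
      by (simp only: pderiv_mult poly_add poly_mult) simp
    then show False using deriv by simp
  qed
  then have "card (set_mset A) = size A"
    by (auto simp: size_multiset_overloaded_eq intro!: card_eq_sum[THEN trans] sum.cong
        intro: le_antisym)
  moreover have "set_mset A = {x. x ^ Q = x}"
  proof -
    have "x \<in> set_mset A \<longleftrightarrow> poly p x = 0" for x
      by (auto simp: A(2) poly_prod_mset prod_mset_zero_iff)
    then show ?thesis by (auto simp: root)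
  qed
  ultimately show ?thesis using A(1) \<open>degree p = Q\<close> by (simp add: Q_def)
qed

lemma frobenius_add:
  assumes "(2 :: 'a :: comm_ring_1) = 0"
  shows "(x + y :: 'a) ^ (2 ^ j) = x ^ (2 ^ j) + y ^ (2 ^ j)"
proof (induction j)
  case (Suc j)
  then show ?case
    using assms by (simp add: power2_sum mult.commute[of 2] power_mult)
qed simp

text \<open>Bose and Chowla: the discrete logarithms of \<open>\<theta> + c\<close>, with \<open>c\<close> in the field with
  \<open>2 ^ j\<close> elements and \<open>\<theta>\<close> of degree two over it, form a Sidon set.\<close>

lemma sidon_set_exists:
  assumes "j \<ge> 1"
  shows "\<exists>D :: nat set. card D = 2 ^ j \<and> D \<subseteq> {..<(2 ^ j) ^ 2} \<and>
    (\<forall>a\<in>D. \<forall>b\<in>D. \<forall>c\<in>D. \<forall>d\<in>D. a + b = c + d \<longrightarrow> a = c \<or> a = d)"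
proof -
  have two: "(2 :: bit alg_closure) = 0"
    by (metis bit_2_eq_0 to_ac_0 to_ac_numeral)
  define q :: nat where "q = 2 ^ j"
  \<comment> \<open>Inside the algebraic closure of GF(2), the fixed points of these two Frobenius
    powers are the fields with \<open>q\<close> and \<open>q ^ 2\<close> elements.\<close>
  define F K :: "bit alg_closure set" where "F = {x. x ^ q = x}" and "K = {x. x ^ (q ^ 2) = x}"
  have q2: "q ^ 2 = 2 ^ (2 * j)" by (simp add: q_def power_mult mult.commute)
  have q: "q \<ge> 2" using assms by (cases j) (auto simp: q_def)
  have card: "card F = q" "card K = q ^ 2"
    unfolding F_def K_def q2 unfolding q_def using assms by (auto intro!: card_frobenius_fixed two)
  have fin: "finite F" "finite K" using card q by (auto intro: card_ge_0_finite)
  have neg: "- x = x" for x :: "bit alg_closure"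
    using two by (metis add.inverse_unique mult_2 mult_zero_left)
  have addF: "x + y \<in> F" and mulF: "x * y \<in> F" and divF: "x / y \<in> F" and diffF: "x - y \<in> F"
    if "x \<in> F" "y \<in> F" for x y
  proof -
    show "x + y \<in> F" using that unfolding F_def q_def by (simp add: frobenius_add two)
    then show "x - y \<in> F" using neg[of y] by (metis diff_conv_add_uminus)
  qed (use that in \<open>auto simp: F_def power_mult_distrib power_divide\<close>)
  have addK: "x + y \<in> K" and mulK: "x * y \<in> K" and divK: "x / y \<in> K"
    if "x \<in> K" "y \<in> K" for x y
  proof -
    show "x + y \<in> K" using that unfolding K_def q2 by (simp add: frobenius_add two)
  qed (use that in \<open>auto simp: K_def power_mult_distrib power_divide\<close>)
  have K01: "0 \<in> K" "1 \<in> K" using q by (auto simp: K_def)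
  have FK: "F \<subseteq> K" by (auto simp: F_def K_def power2_eq_square power_mult)
  \<comment> \<open>\<open>K\<close> is packaged as a ring record so that the cyclicity of the
    multiplicative group of a finite field yields a generator \<open>g\<close>.\<close>
  define R :: "bit alg_closure ring" where "R = \<lparr>carrier = K, monoid.mult = (*), one = 1, ring.zero = 0, add = (+)\<rparr>"
  have "cring R"
  proof (rule cringI)
    show "abelian_group R"
    proof (rule abelian_groupI)
      show "\<exists>y\<in>carrier R. y \<oplus>\<^bsub>R\<^esub> x = \<zero>\<^bsub>R\<^esub>" if "x \<in> carrier R" for x
        using that neg[of x] by (intro bexI[of _ x]) (auto simp: R_def add_eq_0_iff)
    qed (auto simp: R_def addK K01 add_ac)
    show "Group.comm_monoid R"
      by (rule comm_monoidI) (auto simp: R_def mulK K01 mult_ac)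
  qed (auto simp: R_def distrib_right)
  then interpret R: cring R .
  have "field R"
  proof (rule R.cring_fieldI2)
    show "\<exists>b\<in>carrier R. a \<otimes>\<^bsub>R\<^esub> b = \<one>\<^bsub>R\<^esub>"
      if "a \<in> carrier R" "a \<noteq> \<zero>\<^bsub>R\<^esub>" for a
      using divK[OF K01(2), of a] that by (intro bexI[of _ "1 / a"]) (auto simp: R_def)
  qed (simp add: R_def)
  then interpret R: field R .
  have KR: "carrier (mult_of R) = K - {0}" by (simp add: R_def)
  obtain g where "g \<in> carrier (mult_of R)"
    and gen: "carrier (mult_of R) = {g [^]\<^bsub>R\<^esub> i | i :: nat. i \<in> UNIV}"
    using R.finite_field_mult_group_has_gen fin by (auto simp: R_def)
  then have g: "g \<in> K" "g \<noteq> 0" unfolding KR by auto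
  have pow: "g [^]\<^bsub>R\<^esub> (i :: nat) = g ^ i" for i
    by (induction i) (auto simp: R_def)
  have gQ: "g ^ (q ^ 2 - 1) = 1"
  proof -
    have "q ^ 2 = Suc (q ^ 2 - 1)" using q by simp
    then have "g * g ^ (q ^ 2 - 1) = g ^ (q ^ 2)" by (metis power_Suc)
    then show ?thesis using g by (simp add: K_def)
  qed
  \<comment> \<open>Exponents can be reduced modulo \<open>q ^ 2 - 1\<close> by \<open>gQ\<close>;
    the function \<open>l\<close> obtained from this is a discrete logarithm to base
    \<open>g\<close>.\<close>
  have "\<exists>i < q ^ 2. g ^ i = x" if "x \<in> K" "x \<noteq> 0" for x
  proof -
    have "x \<in> {g ^ i | i :: nat. i \<in> UNIV}"
      using that unfolding gen[unfolded KR pow, symmetric] by simp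
    then obtain i where "x = g ^ i" by blast
    also have "i = (q ^ 2 - 1) * (i div (q ^ 2 - 1)) + i mod (q ^ 2 - 1)" by simp
    also have "g ^ \<dots> = g ^ (i mod (q ^ 2 - 1))"
      by (simp only: power_add power_mult gQ power_one mult_1_left)
    finally have "g ^ (i mod (q ^ 2 - 1)) = x" ..
    moreover have "1 < q ^ 2" using q by (intro one_less_power) auto
    then have "i mod (q ^ 2 - 1) < q ^ 2 - 1" by (intro mod_less_divisor) simp
    then have "i mod (q ^ 2 - 1) < q ^ 2" by linarith
    ultimately show ?thesis by blast
  qed
  then obtain l where l: "\<And>x. x \<in> K \<Longrightarrow> x \<noteq> 0 \<Longrightarrow> l x < q ^ 2 \<and> g ^ l x = x"
    by metis
  have "\<not> K \<subseteq> F"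
  proof
    assume "K \<subseteq> F"
    then have "q ^ 2 \<le> q" using card fin by (metis card_mono)
    then show False using q by (simp add: power2_eq_square)
  qed
  then obtain \<theta> where \<theta>: "\<theta> \<in> K" "\<theta> \<notin> F" by blast
  have \<theta>_c: "\<theta> + c \<in> K" "\<theta> + c \<noteq> 0" if "c \<in> F" for c
  proof -
    show "\<theta> + c \<in> K" using that \<theta> FK addK by blast
    show "\<theta> + c \<noteq> 0"
    proof
      assume "\<theta> + c = 0"
      then have "\<theta> = - c" by (simp only: eq_neg_iff_add_eq_0)
      then show False using that \<theta> neg[of c] by simp
    qed
  qed
  define L where "L c = l (\<theta> + c)" for c
  have L: "L c < q ^ 2" "g ^ L c = \<theta> + c" if "c \<in> F" for c
    using l \<theta>_c[OF that] by (auto simp: L_def)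
  have inj: "inj_on L F"
  proof (rule inj_onI)
    fix c d assume "c \<in> F" "d \<in> F" "L c = L d"
    then have "\<theta> + c = \<theta> + d" using L(2) by metis
    then show "c = d" by simp
  qed
  have sidon: "a = c \<or> a = d" if F: "a \<in> F" "b \<in> F" "c \<in> F" "d \<in> F" and "L a + L b = L c + L d" for a b c d
  proof -
    have "g ^ L a * g ^ L b = g ^ L c * g ^ L d"
      using that by (simp flip: power_add)
    then have *: "(\<theta> + a) * (\<theta> + b) = (\<theta> + c) * (\<theta> + d)"
      using F by (simp add: L)
    then have lin: "\<theta> * (a + b - (c + d)) = c * d - a * b"
      by (simp add: algebra_simps)
    \<comment> \<open>Otherwise \<open>lin\<close>, from which the square of \<theta> has cancelled,
      would express \<theta> as a quotient of elements of \<open>F\<close>.\<close>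
    have "a + b - (c + d) = 0"
    proof (rule ccontr)
      assume nz: "a + b - (c + d) \<noteq> 0"
      then have "\<theta> = (c * d - a * b) / (a + b - (c + d))"
        using lin by (simp add: field_simps)
      then show False using \<theta> F by (auto simp: addF diffF mulF divF)
    qed
    then have "c + d = a + b" "c * d = a * b" using lin by (auto simp: algebra_simps)
    \<comment> \<open>Pairs with the same sum and product are the roots of the same quadratic
      polynomial.\<close>
    moreover have "(a - c) * (a - d) = a * a - a * (c + d) + c * d" by (simp add: algebra_simps)
    ultimately have "(a - c) * (a - d) = 0" by (simp add: algebra_simps)
    then show ?thesis by simp
  qed
  show ?thesis
  proof (intro exI[of _ "L ` F"] conjI ballI impI)
    show "card (L ` F) = 2 ^ j" using inj card by (simp add: card_image q_def)
    show "L ` F \<subseteq> {..<(2 ^ j) ^ 2}" using L by (auto simp: q_def)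
  qed (use sidon in blast)
qed

section \<open>Circulant bipartite graphs from Sidon sets\<close>

lemma power_of_two_between:
  fixes t :: nat
  assumes "t \<ge> 2"
  shows "\<exists>j\<ge>1. t \<le> 2 ^ j \<and> 2 ^ j \<le> 2 * t - 2"
  using assms
proof (induction t rule: nat_induct_at_least)
  case base
  then show ?case by (intro exI[of _ 1]) auto
next
  case (Suc t)
  then obtain j where j: "j \<ge> 1" "t \<le> 2 ^ j" "2 ^ j \<le> 2 * t - 2" by blast
  show ?case
  proof (cases "Suc t \<le> 2 ^ j")
    case True
    then show ?thesis using j by (intro exI[of _ j]) auto
  next
    case False
    then have "2 ^ j = t" using j by linarith
    then show ?thesis using Suc.hyps by (intro exI[of _ "Suc j"]) auto
  qed
qed

text \<open>\<open>P\<close> is the biadjacency relation of a bipartite graph with \<open>m\<close>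
  vertices on each side; the last conjunct excludes 4-cycles.\<close>

definition regular_C4_free :: "nat \<Rightarrow> nat \<Rightarrow> (nat \<times> nat) set \<Rightarrow> bool" where
  "regular_C4_free d m P \<longleftrightarrow> P \<subseteq> {..<m} \<times> {..<m} \<and>
    (\<forall>x<m. card {y. (x, y) \<in> P} = d) \<and> (\<forall>y<m. card {x. (x, y) \<in> P} = d) \<and>
    (\<forall>x x' y y'. (x, y) \<in> P \<and> (x, y') \<in> P \<and> (x', y) \<in> P \<and> (x', y') \<in> P \<longrightarrow> x = x' \<or> y = y')"

text \<open>Joining \<open>x\<close> to \<open>x + d\<close> modulo \<open>m\<close> for all
  \<open>d\<close> in a Sidon set gives a regular graph in which a 4-cycle would violate the Sidon
  property. The slack \<open>t\<close> in the second hypothesis lets the lemma serve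
  \<open>m = n - h\<close> with \<open>h < t\<close> as well.\<close>

lemma regular_C4_free_exists:
  fixes t m :: nat
  assumes "t \<ge> 2" "8 * t ^ 2 \<le> m + t"
  shows "\<exists>P. regular_C4_free (t - 1) m P"
proof -
  \<comment> \<open>A Sidon set of size \<open>2 ^ j\<close> in this range has \<open>t - 1\<close>
    elements to choose from, and the square of \<open>2 ^ j\<close> fits twice into
    \<open>m\<close>.\<close>
  obtain j where j: "j \<ge> 1" "t \<le> 2 ^ j" "2 ^ j \<le> 2 * t - 2"
    using power_of_two_between[OF assms(1)] by blast
  obtain D0 :: "nat set" where D0: "card D0 = 2 ^ j" "D0 \<subseteq> {..<(2 ^ j) ^ 2}"
    and sidon: "\<And>a b c d. a \<in> D0 \<Longrightarrow> b \<in> D0 \<Longrightarrow> c \<in> D0 \<Longrightarrow> d \<in> D0 \<Longrightarrow> a + b = c + d \<Longrightarrow> a = c \<or> a = d"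
    using sidon_set_exists[OF j(1)] by blast
  obtain D where D: "D \<subseteq> D0" "card D = t - 1"
    using obtain_subset_with_card_n[of "t - 1" D0] j(2) D0(1)
    by (metis diff_le_self le_trans)
  have "2 * (2 ^ j) ^ 2 \<le> m"
  proof -
    have "((2 :: nat) ^ j) ^ 2 \<le> (2 * t - 2) ^ 2" using j(3) by (rule power_mono) simp
    also have "2 * \<dots> + t \<le> 8 * t ^ 2"
    proof -
      obtain s where "t = s + 2" using assms(1) by (metis add.commute le_Suc_ex)
      then show ?thesis by (simp add: power2_eq_square algebra_simps)
    qed
    finally show ?thesis using assms(2) by simp
  qed
  then have small: "2 * d < m" if "d \<in> D" for d using D(1) D0(2) that by force
  \<comment> \<open>Both sums lie below \<open>m\<close>, so the congruence is an equality of
    naturals.\<close>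
  have uniq: "a = c \<or> a = d"
    if "a \<in> D" "b \<in> D" "c \<in> D" "d \<in> D" "[a + b = c + d] (mod m)" for a b c d
  proof -
    have "a + b = c + d"
      using that small[OF that(1)] small[OF that(2)] small[OF that(3)] small[OF that(4)]
      by (simp add: cong_def)
    then show ?thesis using sidon that D(1) by blast
  qed
  define P where "P = {(x, (x + d) mod m) | x d. x < m \<and> d \<in> D}"
  have "regular_C4_free (t - 1) m P"
    unfolding regular_C4_free_def
  proof (intro conjI allI impI)
    show "P \<subseteq> {..<m} \<times> {..<m}" by (auto simp: P_def)
    show "card {y. (x, y) \<in> P} = t - 1" if "x < m" for x
    proof -
      have "{y. (x, y) \<in> P} = (\<lambda>d. (x + d) mod m) ` D" using that by (auto simp: P_def)
      moreover have "inj_on (\<lambda>d. (x + d) mod m) D"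
      proof (rule inj_onI)
        fix d e assume de: "d \<in> D" "e \<in> D" "(x + d) mod m = (x + e) mod m"
        then have "[d = e] (mod m)" by (simp add: cong_add_lcancel_nat flip: cong_def)
        then show "d = e" using small[OF de(1)] small[OF de(2)] by (simp add: cong_def)
      qed
      ultimately show ?thesis using D(2) by (simp add: card_image)
    qed
    show "card {x. (x, y) \<in> P} = t - 1" if "y < m" for y
    proof -
      \<comment> \<open>The map sends \<open>x\<close> to \<open>y - x\<close> modulo
        \<open>m\<close>, written so as to avoid truncated subtraction; the same formula inverts
        it.\<close>
      have "bij_betw (\<lambda>x. (y + (m - x)) mod m) {x. (x, y) \<in> P} D"
      proof (rule bij_betw_byWitness[where f' = "\<lambda>d. (y + (m - d)) mod m"])
        have sub: "(y + (m - a)) mod m = b" if "y = (a + b) mod m" "a < m" "b < m" for a b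
        proof -
          have "(y + (m - a)) mod m = (a + b + (m - a)) mod m" unfolding that(1) by (rule mod_add_left_eq)
          also have "a + b + (m - a) = b + m" using that by simp
          finally show ?thesis using that by simp
        qed
        show "\<forall>x\<in>{x. (x, y) \<in> P}. (y + (m - (y + (m - x)) mod m)) mod m = x"
          and "(\<lambda>x. (y + (m - x)) mod m) ` {x. (x, y) \<in> P} \<subseteq> D"
          using sub small by ((fastforce simp: P_def add.commute)+)
        have retr: "((y + (m - d)) mod m + d) mod m = y" if "d \<in> D" for d
        proof -
          have "((y + (m - d)) mod m + d) mod m = (y + (m - d) + d) mod m" by (simp add: mod_add_left_eq)
          also have "y + (m - d) + d = y + m" using small[OF that] by simp
          finally show ?thesis using \<open>y < m\<close> by simp
        qed
        show "(\<lambda>d. (y + (m - d)) mod m) ` D \<subseteq> {x. (x, y) \<in> P}"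
          using retr \<open>y < m\<close> unfolding P_def
          by (clarsimp simp del: mod_add_left_eq) (metis mod_less_divisor gr_implies_not_zero bot_nat_0.not_eq_extremum)
        show "\<forall>d\<in>D. (y + (m - (y + (m - d)) mod m)) mod m = d"
          using sub[OF retr[symmetric]] small \<open>y < m\<close> by fastforce
      qed
      then show ?thesis using D(2) bij_betw_same_card by metis
    qed
    show "x = x' \<or> y = y'"
      if P4: "(x, y) \<in> P \<and> (x, y') \<in> P \<and> (x', y) \<in> P \<and> (x', y') \<in> P" for x x' y y'
    proof -
      obtain a b c d where D': "a \<in> D" "b \<in> D" "c \<in> D" "d \<in> D" and x: "x < m" "x' < m"
        and y: "y = (x + a) mod m" "y' = (x + b) mod m" "y = (x' + c) mod m" "y' = (x' + d) mod m"
        using P4 unfolding P_def by blast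
      \<comment> \<open>Adding these, \<open>x + x'\<close> cancels. Of the two cases left by the
        Sidon property, \<open>a = b\<close> identifies \<open>y\<close> with \<open>y'\<close>, and
        \<open>a = c\<close> identifies \<open>x\<close> with \<open>x'\<close>.\<close>
      have "[x + a = x' + c] (mod m)" "[x' + d = x + b] (mod m)" using y by (simp_all add: cong_def)
      then have "[(x + x') + (a + d) = (x + x') + (b + c)] (mod m)"
        by (auto dest: cong_add simp: add_ac)
      then have "[a + d = b + c] (mod m)" by (simp only: cong_add_lcancel_nat)
      then consider "a = b" | "a = c" using uniq D' by blast
      then show ?thesis
      proof cases
        case 2
        then have "[x = x'] (mod m)" using \<open>[x + a = x' + c] (mod m)\<close> by (simp add: cong_add_rcancel_nat)
        then show ?thesis using x by (simp add: cong_def)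
      qed (use y in simp)
    qed
  qed
  then show ?thesis by blast
qed

subsection \<open>Blocks and their joins\<close>

text \<open>
  The trace of a copy of \<open>K_parts p t\<close> on a block is a set \<open>W\<close> of vertices, coloured by the
  parts of \<open>K_parts p t\<close>.
\<close>

definition multicoloured :: "'a set set \<Rightarrow> nat \<Rightarrow> 'a set \<Rightarrow> ('a \<Rightarrow> nat) \<Rightarrow> bool" where
  "multicoloured E t W c \<longleftrightarrow> finite W \<and>
    (\<forall>u\<in>W. \<forall>v\<in>W. c u \<noteq> c v \<longrightarrow> {u, v} \<in> E) \<and> (\<forall>a. card {u\<in>W. c u = a} \<le> t)"

text \<open>The number of colours is unrestricted, so \<open>b\<close> bounds what the block
  contributes to a copy of \<open>K_parts p t\<close> for every \<open>p\<close>.\<close>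

definition capacity_le :: "nat \<Rightarrow> 'a ugraph \<Rightarrow> nat \<Rightarrow> bool" where
  "capacity_le t G b \<longleftrightarrow> (\<forall>W c. W \<subseteq> verts G \<and> multicoloured (edges G) t W c \<longrightarrow> card W \<le> b)"

lemma capacity_leD:
  assumes "capacity_le t G b" "multicoloured (edges G) t W c" "W \<subseteq> verts G"
  shows "card W \<le> b"
  using assms unfolding capacity_le_def by blast

lemma multicoloured_subset:
  assumes "multicoloured E t W c" "W' \<subseteq> W"
  shows "multicoloured E t W' c"
proof -
  have "card {u\<in>W'. c u = a} \<le> card {u\<in>W. c u = a}" for a
    using assms by (intro card_mono) (auto simp: multicoloured_def)
  then show ?thesis
    using assms unfolding multicoloured_def by (meson finite_subset le_trans subsetD)
qed

text \<open>Pulls a trace in a larger graph back to a block embedded there by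
  \<open>\<sigma>\<close>.\<close>

lemma multicoloured_vimage:
  assumes "multicoloured E t (\<sigma> ` U) c" "inj_on \<sigma> U"
    and "\<And>u v. u \<in> U \<Longrightarrow> v \<in> U \<Longrightarrow> {\<sigma> u, \<sigma> v} \<in> E \<Longrightarrow> {u, v} \<in> E'"
  shows "multicoloured E' t U (c \<circ> \<sigma>)"
proof -
  have "card {u \<in> U. c (\<sigma> u) = a} = card {u \<in> \<sigma> ` U. c u = a}" for a
  proof -
    have "{u \<in> \<sigma> ` U. c u = a} = \<sigma> ` {u \<in> U. c (\<sigma> u) = a}" by auto
    moreover have "inj_on \<sigma> {u \<in> U. c (\<sigma> u) = a}" using assms(2) by (rule inj_on_subset) auto
    ultimately show ?thesis by (simp add: card_image)
  qed
  then show ?thesis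
    using assms unfolding multicoloured_def by (simp add: finite_image_iff)
qed

lemma multicolouredD:
  assumes "multicoloured E t W c"
  shows "finite W" "u \<in> W \<Longrightarrow> v \<in> W \<Longrightarrow> {u, v} \<notin> E \<Longrightarrow> c u = c v" "card {u\<in>W. c u = a} \<le> t"
  using assms by (auto simp: multicoloured_def)

lemma multicoloured_mono_card:
  assumes "multicoloured E t W c" "\<And>u. u \<in> W \<Longrightarrow> c u = a"
  shows "card W \<le> t"
proof -
  have "{u\<in>W. c u = a} = W" using assms(2) by auto
  then show ?thesis using multicolouredD(3)[OF assms(1), of a] by simp
qed

text \<open>Each side is independent, so its vertices in \<open>W\<close> share a colour. If two
  colours occur, the two sides of \<open>W\<close> are completely joined; without 4-cycles one side
  is a single vertex, and \<open>W\<close> is a star with at most \<open>1 + (t - 1)\<close>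
  vertices.\<close>

lemma card_C4_free_le:
  assumes W: "multicoloured E t W c" "W \<subseteq> U \<union> Y" and "t \<ge> 1"
    and indep: "\<And>u v. u \<in> U \<Longrightarrow> v \<in> U \<Longrightarrow> {u, v} \<notin> E" "\<And>u v. u \<in> Y \<Longrightarrow> v \<in> Y \<Longrightarrow> {u, v} \<notin> E"
    and C4: "\<And>u u' v v'. u \<in> U \<Longrightarrow> u' \<in> U \<Longrightarrow> v \<in> Y \<Longrightarrow> v' \<in> Y \<Longrightarrow>
      {u, v} \<in> E \<Longrightarrow> {u, v'} \<in> E \<Longrightarrow> {u', v} \<in> E \<Longrightarrow> {u', v'} \<in> E \<Longrightarrow> u = u' \<or> v = v'"
    and deg: "\<And>u. u \<in> U \<Longrightarrow> card {v\<in>Y. {u, v} \<in> E} \<le> t - 1" "\<And>v. v \<in> Y \<Longrightarrow> card {u\<in>U. {u, v} \<in> E} \<le> t - 1"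
    and fin: "finite U" "finite Y"
  shows "card W \<le> t"
proof (cases "\<exists>a. \<forall>u\<in>W. c u = a")
  case True
  then show ?thesis using multicoloured_mono_card[OF W(1)] by blast
next
  case False
  have mono: "c u = c v" if "u \<in> W \<and> v \<in> W \<and> (u \<in> U \<and> v \<in> U \<or> u \<in> Y \<and> v \<in> Y)" for u v
    using multicolouredD(2)[OF W(1)] indep that by blast
  obtain u v where uv: "u \<in> W \<inter> U" "v \<in> W \<inter> Y" "c u \<noteq> c v"
  proof -
    obtain w where "w \<in> W" using False by blast
    then obtain w' where "w' \<in> W" "c w' \<noteq> c w" using False by blast
    then show thesis
      using that[of w w'] that[of w' w] mono[of w w'] \<open>w \<in> W\<close> W(2) by auto
  qed
  have adj: "{x, y} \<in> E" if "x \<in> W \<inter> U" "y \<in> W \<inter> Y" for x y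
    using that uv mono[of x u] mono[of y v] multicolouredD(2)[OF W(1), of x y] by auto
  have uvXY: "u \<in> U" "v \<in> Y" using uv by auto
  have WE: "card W \<le> card (W \<inter> U) + card (W \<inter> Y)"
    using W(2) by (metis card_Un_le inf.absorb1 inf_sup_distrib1)
  have "W \<inter> U = {u} \<or> W \<inter> Y = {v}"
  proof (rule ccontr)
    assume "\<not> ?thesis"
    then obtain u' v' where "u' \<in> W \<inter> U" "v' \<in> W \<inter> Y" "u' \<noteq> u" "v' \<noteq> v"
      using uv by blast
    then show False using C4[of u u' v v'] adj uv by blast
  qed
  then show ?thesis
  proof
    assume "W \<inter> U = {u}"
    moreover have "card (W \<inter> Y) \<le> card {v\<in>Y. {u, v} \<in> E}"
      using adj uv fin by (intro card_mono) auto
    ultimately show ?thesis using WE deg(1)[OF uvXY(1)] \<open>t \<ge> 1\<close> by simp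
  next
    assume "W \<inter> Y = {v}"
    moreover have "card (W \<inter> U) \<le> card {u\<in>U. {u, v} \<in> E}"
      using adj uv fin by (intro card_mono) auto
    ultimately show ?thesis using WE deg(2)[OF uvXY(2)] \<open>t \<ge> 1\<close> by simp
  qed
qed

text \<open>The edges are counted relative to the complete \<open>k\<close>-partite graph, which makes \<open>f\<close> additive
  under joins.\<close>

definition attainable :: "nat \<Rightarrow> nat \<Rightarrow> nat \<Rightarrow> int \<Rightarrow> nat \<Rightarrow> bool" where
  "attainable n t k f b \<longleftrightarrow> (\<exists>G \<in> multipartite_graphs k (\<lambda>_. n).
     capacity_le t G b \<and> int (k choose 2) * int n ^ 2 + f \<le> int (card (edges G)))"

lemma choose_two_add: "(a + b) choose 2 = (a choose 2) + (b choose 2) + a * b"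
proof (induction a)
  case (Suc a)
  have "Suc m choose 2 = (m choose 2) + m" for m by (simp add: numeral_2_eq_2)
  then show ?case using Suc by simp
qed simp

lemma mem_edges_complete_multipartite:
  "{u, v} \<in> edges (complete_multipartite k s) \<longleftrightarrow>
     fst u < k \<and> fst v < k \<and> fst u \<noteq> fst v \<and> snd u < s (fst u) \<and> snd v < s (fst v)"
  by (cases u; cases v) (auto simp: complete_multipartite_def doubleton_eq_iff)

text \<open>The second graph is shifted to the classes from \<open>k\<close> on and all cross edges
  are added. Their number \<open>k * k' * n ^ 2\<close> is the cross term in
  \<open>choose_two_add\<close>, so \<open>f\<close> adds up; a trace splits into its traces on the
  two blocks, so capacities add up.\<close>

lemma attainable_join:
  assumes "attainable n t k f b" "attainable n t k' f' b'"
  shows "attainable n t (k + k') (f + f') (b + b')"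
proof -
  obtain G where G: "verts G = {..<k} \<times> {..<n}" "edges G \<subseteq> edges (complete_multipartite k (\<lambda>_. n))"
      "capacity_le t G b" "int (k choose 2) * int n ^ 2 + f \<le> int (card (edges G))"
    using assms(1) by (auto simp: attainable_def multipartite_graphs_def)
  obtain G' where G': "verts G' = {..<k'} \<times> {..<n}" "edges G' \<subseteq> edges (complete_multipartite k' (\<lambda>_. n))"
      "capacity_le t G' b'" "int (k' choose 2) * int n ^ 2 + f' \<le> int (card (edges G'))"
    using assms(2) by (auto simp: attainable_def multipartite_graphs_def)
  define \<sigma> :: "nat \<times> nat \<Rightarrow> nat \<times> nat" where "\<sigma> = (\<lambda>(i, x). (i + k, x))"
  have inj: "inj \<sigma>" by (auto simp: \<sigma>_def inj_def)
  define V where "V = {..<k} \<times> {..<n}"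
  define V' where "V' = {k..<k + k'} \<times> {..<n}"
  have V': "V' = \<sigma> ` ({..<k'} \<times> {..<n})"
  proof -
    have "{k..<k + k'} = (\<lambda>i. i + k) ` {..<k'}"
      by (simp add: lessThan_atLeast0 add.commute)
    then show ?thesis by (auto simp: V'_def \<sigma>_def)
  qed
  define C where "C = (\<lambda>(u, v). {u, v}) ` (V \<times> V')"
  define E' where "E' = (\<lambda>e. \<sigma> ` e) ` edges G'"
  define H where "H = \<lparr>verts = {..<k + k'} \<times> {..<n}, edges = edges G \<union> E' \<union> C\<rparr>"
  \<comment> \<open>Nonemptiness is recorded because an edge common to both blocks would be
    contained in \<open>V \<inter> V'\<close>, which is empty.\<close>
  have sub: "e \<subseteq> V \<and> e \<noteq> {}" if "e \<in> edges G" for e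
    using that G(2) by (auto simp: complete_multipartite_def V_def)
  have sub': "e \<subseteq> V' \<and> e \<noteq> {}" if "e \<in> E'" for e
    using that G'(2) by (auto simp: complete_multipartite_def V' E'_def)
  have VV': "V \<inter> V' = {}" by (auto simp: V_def V'_def)
  have fin: "finite V" "finite V'" by (auto simp: V_def V'_def)
  have "finite (edges G)" "finite E'"
    using sub sub' fin by (auto intro: finite_subset[of _ "Pow V"] finite_subset[of _ "Pow V'"])
  moreover have "edges G \<inter> E' = {}" using sub sub' VV' by blast
  moreover have "(edges G \<union> E') \<inter> C = {}"
  proof -
    have "\<not> e \<subseteq> V \<and> \<not> e \<subseteq> V'" if "e \<in> C" for e using that VV' by (auto simp: C_def)
    then show ?thesis using sub sub' by blast
  qed
  moreover have "finite C" using fin by (simp add: C_def)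
  ultimately have "card (edges H) = card (edges G) + card E' + card C"
    by (simp add: H_def card_Un_disjoint)
  moreover have "card E' = card (edges G')"
    unfolding E'_def using inj by (intro card_image) (simp add: inj_on_def inj_image_eq_iff)
  moreover have "card C = k * k' * n ^ 2"
  proof -
    have "inj_on (\<lambda>(u, v). {u, v}) (V \<times> V')" using VV' by (auto simp: inj_on_def doubleton_eq_iff)
    then show ?thesis by (simp add: C_def card_image card_cartesian_product V_def V'_def power2_eq_square)
  qed
  ultimately have "int ((k + k') choose 2) * int n ^ 2 + (f + f') \<le> int (card (edges H))"
    using G(4) G'(4) by (simp add: choose_two_add algebra_simps)
  moreover have "H \<in> multipartite_graphs (k + k') (\<lambda>_. n)"
  proof -
    have "edges G \<subseteq> edges (complete_multipartite (k + k') (\<lambda>_. n))"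
      using G(2) by (fastforce simp: complete_multipartite_def)
    moreover have "E' \<subseteq> edges (complete_multipartite (k + k') (\<lambda>_. n))"
    proof
      fix e assume "e \<in> E'"
      then obtain i x j y where "e = \<sigma> ` {(i, x), (j, y)}" "i < k'" "j < k'" "i \<noteq> j" "x < n" "y < n"
        using G'(2) by (auto simp: E'_def complete_multipartite_def)
      then show "e \<in> edges (complete_multipartite (k + k') (\<lambda>_. n))"
        by (simp add: \<sigma>_def mem_edges_complete_multipartite)
    qed
    moreover have "C \<subseteq> edges (complete_multipartite (k + k') (\<lambda>_. n))"
      by (auto simp: C_def V_def V'_def mem_edges_complete_multipartite)
    ultimately show ?thesis by (auto simp: multipartite_graphs_def H_def)
  qed
  moreover have "capacity_le t H (b + b')"
    unfolding capacity_le_def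
  proof (intro allI impI, elim conjE)
    fix W c assume W: "W \<subseteq> verts H" "multicoloured (edges H) t W c"
    \<comment> \<open>Cross edges never lie inside one block, so adjacency within a block is
      inherited from that block alone.\<close>
    have not_C: "{u, v} \<notin> C" if "u \<in> V \<and> v \<in> V \<or> u \<in> V' \<and> v \<in> V'" for u v
      using that VV' by (auto simp: C_def doubleton_eq_iff)
    have "{u, v} \<in> edges G" if "u \<in> V" "v \<in> V" "{u, v} \<in> edges H" for u v
      using that not_C[of u v] sub'[of "{u, v}"] VV' by (auto simp: H_def)
    then have "multicoloured (edges G) t (W \<inter> V) (c \<circ> id)"
      using multicoloured_subset[OF W(2), of "W \<inter> V"]
      by (intro multicoloured_vimage[where \<sigma> = id and E = "edges H"]) simp_all
    then have 1: "card (W \<inter> V) \<le> b" by (rule capacity_leD[OF G(3)]) (simp add: G(1) V_def)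
    define U where "U = \<sigma> -` W \<inter> verts G'"
    have WU: "W \<inter> V' = \<sigma> ` U" by (auto simp: U_def V' G'(1))
    have "{u, v} \<in> edges G'" if "u \<in> U" "v \<in> U" "{\<sigma> u, \<sigma> v} \<in> edges H" for u v
    proof -
      have "\<sigma> u \<in> V'" "\<sigma> v \<in> V'" using that WU by auto
      then have "{\<sigma> u, \<sigma> v} \<in> E'"
        using that not_C[of "\<sigma> u" "\<sigma> v"] sub[of "{\<sigma> u, \<sigma> v}"] VV' by (auto simp: H_def)
      then have "\<sigma> ` {u, v} \<in> (`) \<sigma> ` edges G'" by (simp add: E'_def)
      then show ?thesis using inj by (auto simp: inj_image_eq_iff image_iff simp del: image_insert)
    qed
    moreover have "multicoloured (edges H) t (\<sigma> ` U) c"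
      unfolding WU[symmetric] by (rule multicoloured_subset[OF W(2)]) simp
    ultimately have "multicoloured (edges G') t U (c \<circ> \<sigma>)"
      using inj_on_subset[OF inj subset_UNIV]
      by (intro multicoloured_vimage[where \<sigma> = \<sigma> and E = "edges H"]) simp_all
    then have "card U \<le> b'" by (rule capacity_leD[OF G'(3)]) (simp add: U_def)
    then have 2: "card (W \<inter> V') \<le> b'" using WU inj by (metis card_image inj_on_subset subset_UNIV)
    have "W = (W \<inter> V) \<union> (W \<inter> V')" using W(1) by (auto simp: H_def V_def V'_def)
    then have "card W \<le> card (W \<inter> V) + card (W \<inter> V')" by (metis card_Un_le)
    then show "card W \<le> b + b'" using 1 2 by simp
  qed
  ultimately show ?thesis unfolding attainable_def by blast
qed

lemma attainable_zero: "attainable n t 0 0 0"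
  unfolding attainable_def
  by (rule bexI[of _ "\<lparr>verts = {}, edges = {}\<rparr>"]) (auto simp: multipartite_graphs_def capacity_le_def numeral_2_eq_2)

lemma attainable_repeat:
  assumes "attainable n t k f b"
  shows "attainable n t (m * k) (int m * f) (m * b)"
proof (induction m)
  case (Suc m)
  then show ?case using attainable_join[OF assms Suc] by (simp add: algebra_simps)
qed (simp add: attainable_zero)

text \<open>One class is independent, so a trace on it has a single colour.\<close>

lemma attainable_single: "attainable n t 1 0 t"
proof -
  have "card W \<le> t" if "W \<subseteq> {..<Suc 0} \<times> {..<n}" and W: "multicoloured {} t W c" for W c
  proof (cases "W = {}")
    case False
    then obtain w where "w \<in> W" by blast
    then have "c u = c w" if "u \<in> W" for u
      using that multicolouredD(2)[OF W, of u w] by simp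
    then show ?thesis by (rule multicoloured_mono_card[OF W])
  qed simp
  then show ?thesis unfolding attainable_def
    by (intro bexI[of _ "\<lparr>verts = {..<1} \<times> {..<n}, edges = {}\<rparr>"])
      (auto simp: multipartite_graphs_def capacity_le_def numeral_2_eq_2)
qed

subsection \<open>Blocks on two and three classes\<close>

definition between :: "nat \<Rightarrow> nat \<Rightarrow> (nat \<times> nat) set \<Rightarrow> (nat \<times> nat) set set" where
  "between i j P = (\<lambda>(x, y). {(i, x), (j, y)}) ` P"

lemma mem_between:
  "{(i', x), (j', y)} \<in> between i j P \<longleftrightarrow>
     i' = i \<and> j' = j \<and> (x, y) \<in> P \<or> i' = j \<and> j' = i \<and> (y, x) \<in> P"
  by (auto simp: between_def doubleton_eq_iff image_iff)

lemma card_between: "i \<noteq> j \<Longrightarrow> card (between i j P) = card P"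
  unfolding between_def by (intro card_image) (auto simp: inj_on_def doubleton_eq_iff)

lemma finite_between: "finite P \<Longrightarrow> finite (between i j P)"
  by (simp add: between_def)

lemma between_subset:
  assumes "P \<subseteq> {..<n} \<times> {..<n}" "i < k" "j < k" "i \<noteq> j"
  shows "between i j P \<subseteq> edges (complete_multipartite k (\<lambda>_. n))"
  using assms by (auto simp: between_def mem_edges_complete_multipartite)

lemma card_fibres:
  assumes "finite A" "finite B" "P \<subseteq> A \<times> B" "\<And>x. x \<in> A \<Longrightarrow> card {y. (x, y) \<in> P} = d"
  shows "card P = card A * d"
proof -
  have "P = (SIGMA x:A. {y. (x, y) \<in> P})" using assms(3) by auto
  moreover have "finite {y. (x, y) \<in> P}" for x
    using assms(2,3) by (auto intro: finite_subset[of _ B])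
  ultimately have "card P = (\<Sum>x\<in>A. card {y. (x, y) \<in> P})"
    using card_SigmaI[OF assms(1), of "\<lambda>x. {y. (x, y) \<in> P}"] by metis
  then show ?thesis using assms(4) by simp
qed

lemma card_regular_C4_free:
  assumes "regular_C4_free d m P"
  shows "card P = m * d"
  using card_fibres[of "{..<m}" "{..<m}" P d] assms by (simp add: regular_C4_free_def)

text \<open>The set \<open>E\<close> has to agree with \<open>P\<close> only on positions from
  \<open>h\<close> on, so the bound also applies to the unmoved vertices inside the merged block;
  the plain pair uses \<open>h = 0\<close>.\<close>

lemma card_regular_C4_free_le:
  fixes i j :: nat
  assumes P: "regular_C4_free (t - 1) m P" and "t \<ge> 1" "i \<noteq> j"
    and E: "\<And>x y. x < m \<Longrightarrow> y < m \<Longrightarrow> {(i, x + h), (j, y + h)} \<in> E \<longleftrightarrow> (x, y) \<in> P"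
      "\<And>x y. {(i, x), (i, y)} \<notin> E" "\<And>x y. {(j, x), (j, y)} \<notin> E"
    and W: "multicoloured E t W c" "W \<subseteq> {i, j} \<times> {h..<h + m}"
  shows "card W \<le> t"
proof (rule card_C4_free_le[OF W(1), of "{i} \<times> {h..<h + m}" "{j} \<times> {h..<h + m}"])
  have shift: "\<exists>z<m. u = (i', z + h)" if "u \<in> {i'} \<times> {h..<h + m}" for u and i' :: nat
    using that by (intro exI[of _ "snd u - h"]) auto
  have P': "P \<subseteq> {..<m} \<times> {..<m}" "\<And>x. x < m \<Longrightarrow> card {y. (x, y) \<in> P} = t - 1"
    "\<And>y. y < m \<Longrightarrow> card {x. (x, y) \<in> P} = t - 1"
    "\<And>x x' y y'. (x, y) \<in> P \<Longrightarrow> (x, y') \<in> P \<Longrightarrow> (x', y) \<in> P \<Longrightarrow> (x', y') \<in> P \<Longrightarrow> x = x' \<or> y = y'"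
    using P unfolding regular_C4_free_def by blast+
  show "card {v \<in> {j} \<times> {h..<h + m}. {u, v} \<in> E} \<le> t - 1" if u: "u \<in> {i} \<times> {h..<h + m}" for u
  proof -
    obtain x where x: "u = (i, x + h)" "x < m" using shift[OF u] by blast
    have "{v \<in> {j} \<times> {h..<h + m}. {u, v} \<in> E} = (\<lambda>y. (j, y + h)) ` {y. (x, y) \<in> P}"
      using x E(1)[OF x(2)] P'(1) by (auto simp: image_iff dest!: shift)
    then show ?thesis using P'(2)[OF x(2)] by (simp add: card_image inj_on_def)
  qed
  show "card {u \<in> {i} \<times> {h..<h + m}. {u, v} \<in> E} \<le> t - 1" if v: "v \<in> {j} \<times> {h..<h + m}" for v
  proof -
    obtain y where y: "v = (j, y + h)" "y < m" using shift[OF v] by blast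
    have "{u \<in> {i} \<times> {h..<h + m}. {u, v} \<in> E} = (\<lambda>x. (i, x + h)) ` {x. (x, y) \<in> P}"
      using y E(1)[OF _ y(2)] P'(1) by (auto simp: image_iff dest!: shift)
    then show ?thesis using P'(3)[OF y(2)] by (simp add: card_image inj_on_def)
  qed
  show "u = u' \<or> v = v'"
    if uv: "u \<in> {i} \<times> {h..<h + m}" "u' \<in> {i} \<times> {h..<h + m}" "v \<in> {j} \<times> {h..<h + m}" "v' \<in> {j} \<times> {h..<h + m}"
      "{u, v} \<in> E" "{u, v'} \<in> E" "{u', v} \<in> E" "{u', v'} \<in> E" for u u' v v'
  proof -
    obtain x x' y y' where "u = (i, x + h)" "x < m" "u' = (i, x' + h)" "x' < m"
      "v = (j, y + h)" "y < m" "v' = (j, y' + h)" "y' < m"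
      using uv(1-4)[THEN shift] by blast
    then show ?thesis using uv(5-8) E(1) P'(4)[of x y y' x'] by auto
  qed
qed (use E W(2) \<open>t \<ge> 1\<close> in auto)

text \<open>In \<open>f\<close>, the \<open>n ^ 2\<close> edges of the complete pair are replaced by
  those of a regular C4-free graph.\<close>

lemma attainable_pair:
  assumes "t \<ge> 2" "8 * t ^ 2 \<le> n + t"
  shows "attainable n t 2 (int ((t - 1) * n) - int n ^ 2) t"
proof -
  obtain P where P: "regular_C4_free (t - 1) n P" using regular_C4_free_exists assms by blast
  then have Psub: "P \<subseteq> {..<n} \<times> {..<n}" by (simp add: regular_C4_free_def)
  let ?G = "\<lparr>verts = {..<2} \<times> {..<n}, edges = between 0 1 P\<rparr>"
  have "?G \<in> multipartite_graphs 2 (\<lambda>_. n)"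
    using between_subset[OF Psub, of 0 2 1] by (simp add: multipartite_graphs_def)
  moreover have "capacity_le t ?G t"
    unfolding capacity_le_def
  proof (intro allI impI, elim conjE)
    fix W c assume W: "W \<subseteq> verts ?G" "multicoloured (edges ?G) t W c"
    show "card W \<le> t"
    proof (rule card_regular_C4_free_le[OF P, of 0 1 0 "edges ?G" W c])
      show "W \<subseteq> {0, 1} \<times> {0..<0 + n}" using W(1) by auto
    qed (use W assms in \<open>auto simp: mem_between\<close>)
  qed
  moreover have "card (edges ?G) = n * (t - 1)"
    using card_between[of 0 1 P] card_regular_C4_free[OF P] by simp
  ultimately show ?thesis unfolding attainable_def
    by (intro bexI[of _ ?G]) (auto simp: mult.commute)
qed

text \<open>Each class carries one colour, hence at most \<open>t\<close> vertices of a trace. A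
  trace with \<open>2 * t\<close> vertices would fill both bounds in two different colours and so be
  a copy of \<open>K_parts 2 t\<close>.\<close>

lemma attainable_zarankiewicz:
  assumes "t \<ge> 1"
  shows "attainable n t 2 (int (zarankiewicz t n n) - int n ^ 2) (2 * t - 1)"
proof -
  have "{(0, 0), (1, 0)} \<in> edges (K_parts 2 t)"
    using assms by (simp add: K_parts_def mem_edges_complete_multipartite)
  then have "edges (K_parts 2 t) \<noteq> {}" by blast
  then obtain G where G: "G \<in> multipartite_graphs 2 (\<lambda>_. n)" "\<not> contains_copy (K_parts 2 t) G"
    "card (edges G) = zarankiewicz t n n"
    using max_edges_attained(1)[of "K_parts 2 t" 2 "\<lambda>_. n"] by (auto simp: zarankiewicz_def)
  have "capacity_le t G (2 * t - 1)"
    unfolding capacity_le_def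
  proof (intro allI impI, elim conjE, rule ccontr)
    fix W c assume W: "W \<subseteq> verts G" "multicoloured (edges G) t W c" and "\<not> card W \<le> 2 * t - 1"
    then have big: "card W \<ge> 2 * t" by linarith
    define U where "U i = {x. (i, x) \<in> W}" for i
    have Wsub: "W \<subseteq> {..<2} \<times> {..<n}" using W(1) G(1) by (simp add: multipartite_graphs_def)
    have WX: "W = Pair 0 ` U 0 \<union> Pair 1 ` U 1"
    proof -
      have "fst u = 0 \<or> fst u = 1" if "u \<in> W" for u using that Wsub by fastforce
      then show ?thesis by (force simp: U_def image_iff)
    qed
    have "{(i, x), (i, y)} \<notin> edges G" for i x y
      using G(1) by (auto simp: multipartite_graphs_def complete_multipartite_def doubleton_eq_iff)
    then have mono: "c (i, x) = c (i, y)" if "x \<in> U i" "y \<in> U i" for i x y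
      using that by (intro multicolouredD(2)[OF W(2)]) (simp_all add: U_def)
    have finX: "finite (U i)" for i
      using Wsub by (auto simp: U_def intro!: finite_subset[of _ "{..<n}"])
    have le: "card (U i) \<le> t" for i
    proof (cases "U i = {}")
      case False
      then obtain x where x: "x \<in> U i" by blast
      have "card (U i) = card (Pair i ` U i)" by (simp add: card_image inj_on_def)
      also have "\<dots> \<le> t"
      proof (rule multicoloured_mono_card)
        show "multicoloured (edges G) t (Pair i ` U i) c"
          by (rule multicoloured_subset[OF W(2)]) (auto simp: U_def)
        show "c u = c (i, x)" if "u \<in> Pair i ` U i" for u
          using that mono[OF _ x] by (metis imageE)
      qed
      finally show ?thesis .
    qed simp
    have "card W = card (U 0) + card (U 1)"
      unfolding WX by (subst card_Un_disjoint) (auto simp: finX card_image inj_on_def)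
    then have eq: "card (U 0) = t" "card (U 1) = t" using big le[of 0] le[of 1] by linarith+
    obtain x0 x1 where x01: "x0 \<in> U 0" "x1 \<in> U 1" using eq assms
      by (metis all_not_in_conv card.empty not_one_le_zero)
    have "c (0, x0) \<noteq> c (1, x1)"
    proof
      assume "c (0, x0) = c (1, x1)"
      then have "c u = c (0, x0)" if "u \<in> W" for u
        using that[unfolded WX] mono x01 by (metis UnE imageE)
      then have "card W \<le> t" by (rule multicoloured_mono_card[OF W(2)])
      then show False using big assms by linarith
    qed
    then have adj: "{(0, x), (1, y)} \<in> edges G" if "x \<in> U 0" "y \<in> U 1" for x y
      using that x01 mono[of x 0 x0] mono[of y 1 x1] multicolouredD(2)[OF W(2), of "(0, x)" "(1, y)"]
      by (auto simp: U_def)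
    have "\<exists>g. bij_betw g {..<t} (U i)" if "i < 2" for i
      using that eq finX by (intro finite_same_card_bij) (auto simp: less_2_cases_iff)
    then obtain g where g: "\<And>i. i < 2 \<Longrightarrow> bij_betw (g i) {..<t} (U i)" by metis
    define f where "f = (\<lambda>(i, x). (i, g i x))"
    have gX: "g i x \<in> U i" if "i < 2" "x < t" for i x
      using bij_betwE[OF g] that by auto
    have "contains_copy (K_parts 2 t) G"
      unfolding contains_copy_def
    proof (intro exI[of _ f] conjI ballI)
      show "inj_on f (verts (K_parts 2 t))"
        using g by (auto simp: f_def K_parts_def complete_multipartite_def inj_on_def bij_betw_def)
      show "f ` verts (K_parts 2 t) \<subseteq> verts G"
        using gX W(1) by (auto simp: f_def K_parts_def complete_multipartite_def U_def)
      fix e assume "e \<in> edges (K_parts 2 t)"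
      then obtain x y where "e = {(0, x), (1, y)}" "x < t" "y < t"
        by (auto simp: K_parts_def complete_multipartite_def less_2_cases_iff)
      then show "f ` e \<in> edges G" using adj gX by (simp add: f_def)
    qed
    then show False using G(2) by blast
  qed
  then show ?thesis using G unfolding attainable_def by (intro bexI[of _ G]) auto
qed

section \<open>The merged block on three classes\<close>

lemma between_disjoint:
  assumes "{i, j} \<noteq> {i', j'}"
  shows "between i j P \<inter> between i' j' P' = {}"
proof -
  have "fst ` e = {i, j}" if "e \<in> between i j P" for e i j P
    using that by (auto simp: between_def)
  then show ?thesis using assms by blast
qed

lemma card_div_eq:
  assumes "d > 0"
  shows "card {y :: nat. y div d = i} = d"
proof -
  have "y div d = i \<longleftrightarrow> i * d \<le> y \<and> y < i * d + d" for y
  proof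
    assume "y div d = i"
    then show "i * d \<le> y \<and> y < i * d + d"
      using div_times_less_eq_dividend[of y d] dividend_less_div_times[OF assms, of y]
      by (simp add: add.commute)
  next
    assume "i * d \<le> y \<and> y < i * d + d"
    then show "y div d = i" by (intro div_nat_eqI) (simp_all add: mult.commute[of d i])
  qed
  then have "{y. y div d = i} = {i * d..<i * d + d}"
    by (simp only: set_eq_iff mem_Collect_eq atLeastLessThan_iff) simp
  then show ?thesis by simp
qed

text \<open>Used with \<open>t - 1\<close> for \<open>t\<close>, to write the gain
  \<open>h * (d - h)\<close> of the merged block as the floor in the theorem.\<close>

lemma floor_square_div4: "((t :: nat) div 2) * (t - t div 2) = t ^ 2 div 4"
proof (cases "even t")
  case True
  then obtain s where "t = 2 * s" by blast
  then show ?thesis by (simp add: power2_eq_square)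
next
  case False
  then obtain s where t: "t = 2 * s + 1" using oddE by blast
  then have "t ^ 2 = 1 + 4 * (s * (s + 1))" by (simp add: power2_eq_square)
  then have "t ^ 2 div 4 = s * (s + 1)" by simp
  then show ?thesis using t by simp
qed

text \<open>Classes 0, 1, 2 are \<open>A\<close>, \<open>B\<close>, \<open>C\<close>; the moved
  vertices have positions below \<open>h\<close>. There are \<open>n ^ 2 - m ^ 2 + m * d\<close>
  edges from \<open>R\<close> and \<open>m * n + h * d\<close> from each \<open>Q\<close>; with
  \<open>m = n - h\<close> the total is \<open>2 * n ^ 2 + d * n + h * (d - h)\<close>.\<close>

lemma attainable_triple:
  fixes n t :: nat
  assumes "t \<ge> 2" "8 * t ^ 2 \<le> n"
  shows "attainable n t 3 (int ((t - 1) * n + (t - 1) ^ 2 div 4) - int n ^ 2) (2 * t)"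
proof -
  define d h m where "d = t - 1" and "h = d div 2" and "m = n - h"
  have t: "t = d + 1" "d \<ge> 1" using assms by (auto simp: d_def)
  have hd: "2 * h \<le> d" by (simp add: h_def)
  \<comment> \<open>The leaves of the stars have positions below \<open>2 * h * d\<close>, hence
    below \<open>d * d\<close>, so they fit into class 2.\<close>
  have dn: "d * d + d \<le> n" using assms(2) by (simp add: t power2_eq_square)
  have hn: "h < n" "h + m = n" using hd dn t by (auto simp: m_def)
  obtain P where P: "regular_C4_free d m P"
    using regular_C4_free_exists[of t m] assms hn hd unfolding d_def by force
  then have Psub: "P \<subseteq> {..<m} \<times> {..<m}" by (simp add: regular_C4_free_def)
  \<comment> \<open>Centre \<open>x\<close> gets the \<open>d\<close> leaves with quotient
    \<open>x + a\<close>. The offsets 0 for class 0 and \<open>h\<close> for class 1 make all stars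
    disjoint.\<close>
  define S where "S a = {(x, y). x < h \<and> y div d = x + a}" for a
  have S_less: "y < n" if "(x, y) \<in> S a" "a \<le> h" for x y a
  proof -
    have "y div d < d" using that hd by (auto simp: S_def)
    then have "y < d * d" using t by (simp add: div_less_iff_less_mult)
    then show ?thesis using dn by linarith
  qed
  \<comment> \<open>Unmoved vertices keep all edges to class 2, moved ones only their stars.\<close>
  define Q where "Q a = {h..<n} \<times> {..<n} \<union> S a" for a
  \<comment> \<open>Only the pairs of unmoved vertices are thinned out, to a copy of
    \<open>P\<close> shifted by \<open>h\<close>.\<close>
  define R where "R = ({..<n} \<times> {..<n} - {h..<n} \<times> {h..<n}) \<union> (\<lambda>(x, y). (x + h, y + h)) ` P"
  have Qsub: "Q a \<subseteq> {..<n} \<times> {..<n}" if "a \<le> h" for a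
    using S_less[OF _ that] hn by (auto simp: Q_def S_def)
  have Rsub: "R \<subseteq> {..<n} \<times> {..<n}" using Psub hn by (auto simp: R_def)
  have cardQ: "card (Q a) = m * n + h * d" if "a \<le> h" for a
  proof -
    have "card (S a) = h * d"
      using card_fibres[of "{..<h}" "{..<n}" "S a" d] S_less[OF _ that] t card_div_eq[of d]
      by (auto simp: S_def)
    moreover have "finite (S a)" using Qsub[OF that] by (rule_tac finite_subset[of _ "{..<n} \<times> {..<n}"]) (auto simp: Q_def)
    moreover have "{h..<n} \<times> {..<n} \<inter> S a = {}" by (auto simp: S_def)
    ultimately show ?thesis by (simp add: Q_def card_Un_disjoint card_cartesian_product m_def)
  qed
  have cardR: "card R + m ^ 2 = n ^ 2 + m * d"
  proof -
    let ?f = "\<lambda>(x :: nat, y :: nat). (x + h, y + h)"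
    have "card (?f ` P) = m * d"
      using card_regular_C4_free[OF P] by (subst card_image) (auto simp: inj_on_def)
    moreover have "({..<n} \<times> {..<n} - {h..<n} \<times> {h..<n}) \<inter> ?f ` P = {}" using Psub hn by auto
    moreover have "finite (?f ` P)" using Psub by (intro finite_imageI) (auto intro: finite_subset)
    moreover have "card ({..<n} \<times> {..<n} - {h..<n} \<times> {h..<n}) = n * n - m * m"
      by (subst card_Diff_subset) (auto simp: card_cartesian_product m_def)
    moreover have "m * m \<le> n * n" by (intro mult_le_mono) (auto simp: m_def)
    ultimately show ?thesis by (simp add: R_def card_Un_disjoint power2_eq_square)
  qed
  define E where "E = between 0 1 R \<union> between 0 2 (Q 0) \<union> between 1 2 (Q h)"
  define G where "G = \<lparr>verts = {..<3} \<times> {..<n}, edges = E\<rparr>"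
  have "E \<subseteq> edges (complete_multipartite 3 (\<lambda>_. n))"
    using between_subset Rsub Qsub by (simp add: E_def)
  then have "G \<in> multipartite_graphs 3 (\<lambda>_. n)" by (simp add: G_def multipartite_graphs_def)
  have E01: "{(0, x), (1, y)} \<in> E \<longleftrightarrow> (x, y) \<in> R" and E02: "{(0, x), (2, y)} \<in> E \<longleftrightarrow> (x, y) \<in> Q 0"
    and E12: "{(1, x), (2, y)} \<in> E \<longleftrightarrow> (x, y) \<in> Q h" and Eii: "{(i, x), (i, y)} \<notin> E" for x y i
    by (auto simp: E_def mem_between)
  have cardE: "card E = card R + card (Q 0) + card (Q h)"
  proof -
    have "finite R" "finite (Q 0)" "finite (Q h)"
      using Rsub Qsub[of 0] Qsub[of h] by (auto intro: finite_subset[of _ "{..<n} \<times> {..<n}"])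
    moreover have "between 0 1 R \<inter> between 0 2 (Q 0) = {}"
      and "(between 0 1 R \<union> between 0 2 (Q 0)) \<inter> between 1 2 (Q h) = {}"
      using between_disjoint[of 0 1 0 2] between_disjoint[of 0 1 1 2] between_disjoint[of 0 2 1 2]
      by (simp_all add: Int_Un_distrib2 doubleton_eq_iff)
    ultimately show ?thesis by (simp add: E_def card_Un_disjoint card_between finite_between)
  qed
  have "int (3 choose 2) * int n ^ 2 + (int ((t - 1) * n + (t - 1) ^ 2 div 4) - int n ^ 2) = int (card E)"
  proof -
    have "(t - 1) ^ 2 div 4 = h * (d - h)" unfolding d_def[symmetric] h_def by (rule floor_square_div4[symmetric])
    then have T: "int ((t - 1) * n + (t - 1) ^ 2 div 4) = int d * int n + int h * (int d - int h)"
      using hd unfolding d_def[symmetric] by (simp add: of_nat_diff)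
    have R: "int (card R) = int n ^ 2 + int m * int d - int m ^ 2"
      using cardR by (simp flip: of_nat_power of_nat_mult of_nat_add)
    have m: "int m = int n - int h" using hn by simp
    have "(3 :: nat) choose 2 = 3" by (simp add: numeral_eq_Suc)
    moreover have "int (card E) = int (card R) + 2 * (int m * int n + int h * int d)"
      using cardQ[of 0] cardQ[of h] cardE by simp
    ultimately show ?thesis unfolding T R m by (simp add: algebra_simps power2_eq_square)
  qed
  moreover have "capacity_le t G (2 * t)"
    unfolding capacity_le_def
  proof (intro allI impI, elim conjE)
    fix W c assume "W \<subseteq> verts G" and "multicoloured (edges G) t W c"
    then have Wsub: "W \<subseteq> {..<3} \<times> {..<n}" and W: "multicoloured E t W c" by (auto simp: G_def)
    have core: "card (W \<inter> {0, 1} \<times> {h..<h + m}) \<le> t"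
    proof (rule card_regular_C4_free_le[of t m P 0 1 h E])
      show "multicoloured E t (W \<inter> {0, 1} \<times> {h..<h + m}) c" by (rule multicoloured_subset[OF W]) simp
      show "{(0, x + h), (1, y + h)} \<in> E \<longleftrightarrow> (x, y) \<in> P" if "x < m" "y < m" for x y
        unfolding E01 using that hn by (auto simp: R_def)
    qed (use P Eii t in auto)
    \<comment> \<open>A centre has at most \<open>t - 1\<close> leaves and a leaf at most one
      centre, which is within the degree bound as \<open>t \<ge> 2\<close>.\<close>
    have stars: "card (W \<inter> ({i} \<times> {..<h} \<union> {2} \<times> {..<n})) \<le> t"
      if i: "i \<in> {0, 1}" and adj: "\<And>x y. x < h \<Longrightarrow> {(i, x), (2, y)} \<in> E \<longleftrightarrow> y div d = x + a" for i a :: nat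
    proof (rule card_C4_free_le[of E t _ c "{i} \<times> {..<h}" "{2} \<times> {..<n}"])
      show "multicoloured E t (W \<inter> ({i} \<times> {..<h} \<union> {2} \<times> {..<n})) c" by (rule multicoloured_subset[OF W]) simp
      show "card {v \<in> {2} \<times> {..<n}. {u, v} \<in> E} \<le> t - 1" if u: "u \<in> {i} \<times> {..<h}" for u
      proof -
        obtain x where x: "u = (i, x)" "x < h" using u by auto
        have fin: "finite {y. y div d = x + a}" using card_div_eq[of d "x + a"] t by (auto intro: card_ge_0_finite)
        have "{v \<in> {2} \<times> {..<n}. {u, v} \<in> E} \<subseteq> Pair 2 ` {y. y div d = x + a}"
          using x adj[OF x(2)] by blast
        then have "card {v \<in> {2} \<times> {..<n}. {u, v} \<in> E} \<le> card {y. y div d = x + a}"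
          using fin by (rule surj_card_le[rotated])
        then show ?thesis using card_div_eq[of d "x + a"] t by simp
      qed
      show "card {u \<in> {i} \<times> {..<h}. {u, v} \<in> E} \<le> t - 1" if v: "v \<in> {2} \<times> {..<n}" for v
      proof -
        obtain y where y: "v = (2, y)" using v by auto
        have "{u \<in> {i} \<times> {..<h}. {u, v} \<in> E} \<subseteq> {(i, y div d - a)}"
        proof
          fix u assume "u \<in> {u \<in> {i} \<times> {..<h}. {u, v} \<in> E}"
          then obtain x where "u = (i, x)" "x < h" "{(i, x), (2, y)} \<in> E" using y by blast
          then show "u \<in> {(i, y div d - a)}" using adj[of x y] by simp
        qed
        then have "card {u \<in> {i} \<times> {..<h}. {u, v} \<in> E} \<le> card {(i, y div d - a)}"
          by (intro card_mono) simp_all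
        then show ?thesis using t by simp
      qed
      show "u = u' \<or> v = v'"
        if uv: "u \<in> {i} \<times> {..<h}" "u' \<in> {i} \<times> {..<h}" "v \<in> {2} \<times> {..<n}" "{u, v} \<in> E" "{u', v} \<in> E" for u u' v v'
      proof -
        obtain x x' y where "u = (i, x)" "x < h" "u' = (i, x')" "x' < h" "v = (2, y)"
          using uv(1-3) by blast
        then show ?thesis using uv(4,5) adj[of x y] adj[of x' y] by simp
      qed
    qed (use Eii t in auto)
    have adj0: "{(0, x), (2, y)} \<in> E \<longleftrightarrow> y div d = x + 0" if "x < h" for x y
      unfolding E02 using that by (auto simp: Q_def S_def)
    have adj1: "{(1, x), (2, y)} \<in> E \<longleftrightarrow> y div d = x + h" if "x < h" for x y
      unfolding E12 using that by (auto simp: Q_def S_def)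
    have cover: "u \<in> {0, 1} \<times> {h..<h + m} \<union> ({0} \<times> {..<h} \<union> {2} \<times> {..<n}) \<union> {1} \<times> {..<h}" if "u \<in> W" for u
    proof -
      have "fst u = 0 \<or> fst u = 1 \<or> fst u = 2" "snd u < n" using that Wsub by fastforce+
      then show ?thesis using hn by (cases u) auto
    qed
    show "card W \<le> 2 * t"
    proof (cases "W \<inter> {0} \<times> {..<h} = {} \<or> W \<inter> {1} \<times> {..<h} = {}")
      case True
      \<comment> \<open>\<open>U\<close> is class 2 together with the moved set that the trace may
        still meet.\<close>
      then have "\<exists>U. card (W \<inter> U) \<le> t \<and> W \<subseteq> {0, 1} \<times> {h..<h + m} \<union> U"
      proof
        assume "W \<inter> {1} \<times> {..<h} = {}"
        then have "W \<subseteq> {0, 1} \<times> {h..<h + m} \<union> ({0} \<times> {..<h} \<union> {2} \<times> {..<n})" using cover by blast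
        then show ?thesis using stars[of 0 0] adj0 by blast
      next
        assume "W \<inter> {0} \<times> {..<h} = {}"
        then have "W \<subseteq> {0, 1} \<times> {h..<h + m} \<union> ({1} \<times> {..<h} \<union> {2} \<times> {..<n})" using cover by blast
        then show ?thesis using stars[of 1 h] adj1 by blast
      qed
      then obtain U where U: "card (W \<inter> U) \<le> t" "W \<subseteq> {0, 1} \<times> {h..<h + m} \<union> U" by blast
      then have "W = W \<inter> {0, 1} \<times> {h..<h + m} \<union> W \<inter> U" by blast
      then have "card W \<le> card (W \<inter> {0, 1} \<times> {h..<h + m}) + card (W \<inter> U)" by (metis card_Un_le)
      then show ?thesis using core U(1) by linarith
    next
      case False
      then obtain x y where xy: "(0, x) \<in> W" "x < h" "(1, y) \<in> W" "y < h" by auto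
      \<comment> \<open>A vertex of a third colour would be adjacent to both moved vertices, hence a
        common leaf in class 2 of two disjoint stars.\<close>
      have two: "c u = c (0, x) \<or> c u = c (1, y)" if u: "u \<in> W" for u
      proof (rule ccontr)
        assume "\<not> ?thesis"
        then have E: "{(0, x), u} \<in> E" "{(1, y), u} \<in> E"
          using multicolouredD(2)[OF W] u xy by metis+
        have "fst u \<noteq> 0" "fst u \<noteq> 1" using E Eii by (metis prod.collapse)+
        then obtain z where "u = (2, z)" using cover[OF u] by auto
        then show False using E adj0 adj1 xy by simp
      qed
      then have "card W = card ({u\<in>W. c u = c (0, x)} \<union> {u\<in>W. c u = c (1, y)})"
        by (intro arg_cong[where f = card]) blast
      also have "\<dots> \<le> card {u\<in>W. c u = c (0, x)} + card {u\<in>W. c u = c (1, y)}" by (rule card_Un_le)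
      also have "\<dots> \<le> 2 * t"
        using multicolouredD(3)[OF W, of "c (0, x)"] multicolouredD(3)[OF W, of "c (1, y)"] by linarith
      finally show ?thesis .
    qed
  qed
  ultimately show ?thesis
    using \<open>G \<in> _\<close> unfolding attainable_def by (intro bexI[of _ G]) (auto simp: G_def)
qed

subsection \<open>The lower bound\<close>

text \<open>Every pair of vertices either is an edge or lies inside one class.\<close>

lemma card_complete_multipartite:
  "card (edges (complete_multipartite r s)) + (\<Sum>i<r. s i choose 2) = (\<Sum>i<r. s i) choose 2"
proof -
  let ?V = "SIGMA i:{..<r}. {..<s i}"
  let ?N = "\<lambda>i. [{i} \<times> {..<s i}]\<^bsup>2\<^esup>"
  let ?E = "edges (complete_multipartite r s)"
  have "[?V]\<^bsup>2\<^esup> = ?E \<union> (\<Union>i<r. ?N i)"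
  proof (intro equalityI subsetI)
    fix e assume "e \<in> [?V]\<^bsup>2\<^esup>"
    then obtain u v where e: "e = {u, v}" "u \<in> ?V" "v \<in> ?V" "u \<noteq> v" by (rule nsets2_E)
    show "e \<in> ?E \<union> (\<Union>i<r. ?N i)"
    proof (cases "fst u = fst v")
      case True
      then have "e \<in> ?N (fst u)" using e by auto
      then show ?thesis using e(2) by auto
    next
      case False
      then show ?thesis using e by (auto simp: mem_edges_complete_multipartite)
    qed
  next
    fix e assume "e \<in> ?E \<union> (\<Union>i<r. ?N i)"
    then show "e \<in> [?V]\<^bsup>2\<^esup>"
      using edges_complete_multipartite[of r s] nsets_mono[of "{i} \<times> {..<s i}" ?V for i] by blast
  qed
  moreover have "?E \<inter> (\<Union>i<r. ?N i) = {}"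
  proof -
    have "fst u = fst v" if "{u, v} \<in> ?N i" for u v i using that by (auto split: if_splits)
    then show ?thesis by (fastforce simp: complete_multipartite_def)
  qed
  moreover have "finite ?E"
    using edges_complete_multipartite[of r s] finite_imp_finite_nsets[OF finite_verts_multipartite]
    by (rule finite_subset)
  moreover have "finite (\<Union>i<r. ?N i)" by (intro finite_UN_I finite_imp_finite_nsets) auto
  ultimately have "card ([?V]\<^bsup>2\<^esup>) = card ?E + card (\<Union>i<r. ?N i)"
    by (simp only: card_Un_disjoint)
  moreover have "card (\<Union>i<r. ?N i) = (\<Sum>i<r. card (?N i))"
  proof (rule card_UN_disjoint)
    show "\<forall>i\<in>{..<r}. \<forall>j\<in>{..<r}. i \<noteq> j \<longrightarrow> ?N i \<inter> ?N j = {}"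
      by (auto elim!: nsets2_E simp: doubleton_eq_iff)
  qed (auto intro: finite_imp_finite_nsets)
  ultimately show ?thesis by (simp add: card_cartesian_product)
qed

text \<open>In this range all parts have size 2 or 1, and the \<open>k - r\<close> parts of size 2
  account for the only nonadjacent pairs.\<close>

lemma turan_number_add:
  assumes "r < k" "k \<le> 2 * r"
  shows "turan_number r k + (k - r) = k choose 2"
proof -
  define s where "s i = (if i < k mod r then k div r + 1 else k div r)" for i
  \<comment> \<open>At \<open>k = 2 * r\<close> the remainder is 0 and the quotient 2; otherwise the
    quotient is 1 and the remainder \<open>k - r\<close>.\<close>
  have si: "s i = (if i < k - r then 2 else 1)" if "i < r" for i
  proof (cases "k = 2 * r")
    case False
    then have "k div r = 1" using assms by (intro div_nat_eqI) auto
    moreover have "k mod r = k - r" using assms False by (simp add: le_mod_geq)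
    ultimately show ?thesis by (simp add: s_def)
  qed (use that in \<open>simp add: s_def\<close>)
  have s: "(\<Sum>i<r. g (s i)) = (k - r) * g 2 + (2 * r - k) * g 1" for g :: "nat \<Rightarrow> nat"
  proof -
    have r: "r - (k - r) = 2 * r - k" using assms by simp
    have "(\<Sum>i<r. g (s i)) = (\<Sum>i<r. if i < k - r then g 2 else g 1)"
      using si by (intro sum.cong) auto
    also have "\<dots> = card ({..<r} \<inter> {i. i < k - r}) * g 2 + card ({..<r} \<inter> - {i. i < k - r}) * g 1"
      by (simp add: sum.If_cases)
    also have "{..<r} \<inter> {i. i < k - r} = {..<k - r}"
      using assms by auto
    also have "{..<r} \<inter> - {i. i < k - r} = {k - r..<r}"
      using assms by auto
    finally show ?thesis using r by (simp only: card_lessThan card_atLeastLessThan)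
  qed
  have "(\<Sum>i<r. s i) = k" using s[of id] assms by simp
  moreover have "(\<Sum>i<r. s i choose 2) = k - r" using s[of "\<lambda>x. x choose 2"] by simp
  ultimately show ?thesis
    using card_complete_multipartite[of r s] by (simp add: turan_number_def turan_graph_def s_def[abs_def])
qed

text \<open>The image of a copy, coloured by the parts it comes from, is a trace with
  \<open>p * t\<close> vertices.\<close>

lemma capacity_less_imp_no_copy:
  assumes "capacity_le t G b" "b < p * t"
  shows "\<not> contains_copy (K_parts p t) G"
proof
  assume "contains_copy (K_parts p t) G"
  then obtain f where f: "inj_on f ({..<p} \<times> {..<t})" "f ` ({..<p} \<times> {..<t}) \<subseteq> verts G"
    and E: "\<forall>e\<in>edges (K_parts p t). f ` e \<in> edges G"
    by (auto simp: contains_copy_def K_parts_def complete_multipartite_def)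
  let ?V = "{..<p} \<times> {..<t}"
  define c where "c = fst \<circ> the_inv_into ?V f"
  have c: "c (f u) = fst u" if "u \<in> ?V" for u
    using the_inv_into_f_f[OF f(1) that] by (simp add: c_def)
  have "multicoloured (edges G) t (f ` ?V) c"
    unfolding multicoloured_def
  proof (intro conjI ballI allI impI)
    fix a b assume "a \<in> f ` ?V" "b \<in> f ` ?V" "c a \<noteq> c b"
    then obtain u v where uv: "a = f u" "b = f v" "u \<in> ?V" "v \<in> ?V" by blast
    then have "{u, v} \<in> edges (K_parts p t)"
      using \<open>c a \<noteq> c b\<close> c by (auto simp: K_parts_def mem_edges_complete_multipartite)
    then show "{a, b} \<in> edges G" using E uv by force
  next
    fix a
    have "{w \<in> f ` ?V. c w = a} \<subseteq> f ` ({a} \<times> {..<t})" using c by auto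
    then have "card {w \<in> f ` ?V. c w = a} \<le> card ({a} \<times> {..<t})" by (intro surj_card_le) auto
    then show "card {w \<in> f ` ?V. c w = a} \<le> t" by (simp add: card_cartesian_product)
  qed simp
  then have "card (f ` ?V) \<le> b" using f(2) by (rule capacity_leD[OF assms(1)])
  then show False using assms(2) f(1) by (simp add: card_image card_cartesian_product)
qed

theorem theorem1p2:
  fixes t r k n :: nat
  assumes "t \<ge> 2" and "r \<ge> 1" and "r < k" and "k \<le> 2 * r" and "n \<ge> 8 * t ^ 2"
  shows "ex_partite k n (K_parts (r + 1) t)
    \<ge> turan_number r k * n ^ 2 + zarankiewicz t n n + (t - 1) * (k - r - 1) * n
      + min (k - r - 1) (2 * r - k) * ((t - 1) ^ 2 div 4)"
proof -
  \<comment> \<open>Besides the Zarankiewicz pair there are \<open>p\<close> pairs and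
    \<open>s\<close> single classes. As many as possible, \<open>q\<close> of each, are merged into
    triples; \<open>p'\<close> and \<open>s'\<close> remain.\<close>
  define p s where "p = k - r - 1" and "s = 2 * r - k"
  define q where "q = min p s"
  define p' s' where "p' = p - q" and "s' = s - q"
  have ps: "p = p' + q" "s = s' + q" by (auto simp: p'_def s'_def q_def)
  have k: "k = 2 + (q * 3 + (p' * 2 + s' * 1))" and r: "r = 1 + p + s"
    using assms ps by (auto simp: p_def s_def)
  let ?B = "(t - 1) ^ 2 div 4"
  define d where "d = t - 1"
  define b where "b = 2 * t - 1 + (q * (2 * t) + (p' * t + s' * t))"
  have "attainable n t k ((int (zarankiewicz t n n) - int n ^ 2) + (int q * (int ((t - 1) * n + ?B) - int n ^ 2)
      + (int p' * (int ((t - 1) * n) - int n ^ 2) + int s' * 0))) b"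
    unfolding k b_def using assms
    by (intro attainable_join attainable_zarankiewicz attainable_repeat attainable_triple
        attainable_pair attainable_single) auto
  then obtain G where G: "G \<in> multipartite_graphs k (\<lambda>_. n)" "capacity_le t G b"
    "int (k choose 2) * int n ^ 2 + ((int (zarankiewicz t n n) - int n ^ 2) + (int q * (int ((t - 1) * n + ?B) - int n ^ 2)
      + (int p' * (int ((t - 1) * n) - int n ^ 2) + int s' * 0))) \<le> int (card (edges G))"
    unfolding attainable_def by blast
  \<comment> \<open>A triple has the capacity of a pair and a single class together, so the
    Zarankiewicz block alone accounts for the -1.\<close>
  have "b = (r + 1) * t - 1" using assms(1) by (simp add: b_def r ps algebra_simps)
  then have "b < (r + 1) * t" using assms(1) by simp
  \<comment> \<open>The \<open>p + 1\<close> pairs missing from the Turan graph match the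
    \<open>p + 1\<close> terms \<open>- n ^ 2\<close> in \<open>f\<close>, one from each triple,
    each remaining pair and the Zarankiewicz block.\<close>
  have "int (k choose 2) = int (turan_number r k) + int p + 1"
    using turan_number_add[of r k] assms by (simp add: p_def)
  then have "int (turan_number r k * n ^ 2 + zarankiewicz t n n + (t - 1) * p * n + q * ?B) \<le> int (card (edges G))"
    using G(3) unfolding ps(1) d_def[symmetric] by (simp add: algebra_simps)
  also have "card (edges G) \<le> ex_partite k n (K_parts (r + 1) t)"
    unfolding ex_partite_def
  proof (rule max_edges_attained(2)[OF _ G(1)])
    have "{(0, 0), (1, 0)} \<in> edges (K_parts (r + 1) t)"
      using assms by (simp add: K_parts_def mem_edges_complete_multipartite)
    then show "edges (K_parts (r + 1) t) \<noteq> {}" by blast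
    show "\<not> contains_copy (K_parts (r + 1) t) G"
      using G(2) \<open>b < _\<close> by (rule capacity_less_imp_no_copy)
  qed
  finally show ?thesis by (simp only: of_nat_le_iff p_def q_def s_def)
qed

end
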